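(* Fix $\alpha\in(0,1)$. Consider the hierarchical component-wise split conformal procedure with signed scores and data-based projection matrix described in the context, used with any regression algorithm $\mathcal{A}$ and any function $\mathcal{P}$ outputting matrices $P$ such that $PH=H$. Assume that the residuals $\widehat{\boldsymbol{s}}_t=\boldsymbol{y}_t-\widehat{\boldsymbol{\mu}}(\boldsymbol{x}_t)\in\mathbb{R}^m$, for $t\in\mathcal{D}_{\mathrm{calib}}\cup\{T+1\}$, are i.i.d. (this is in particular the case when the data $(\boldsymbol{x}_t,\boldsymbol{y}_t)_{1\leq t\leq T+1}$ are i.i.d.). Then $$\forall i\in\{1,\ldots,m\},\qquad \mathbb{P}\bigl(y_{T+1,i}\in\widetilde{C}_i(\boldsymbol{x}_{T+1})\bigr)\ \geq\ 1-\alpha .$$ In addition, if the non-conformity scores $(\widetilde{\boldsymbol{s}}_t)_{t\in\mathcal{D}_{\mathrm{calib}}\cup\{T+1\}}$ are almost surely distinct, then $$\forall i\in\{1,\ldots,m\},\qquad \mathbb{P}\bigl(y_{T+1,i}\in\widetilde{C}_i(\boldsymbol{x}_{T+1})\bigr)\ \leq\ 1-\alpha+\frac{2}{T_{\mathrm{calib}}+1}.$$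
   Context: Hierarchical data: let $m\geq 3$, $2\leq n<m$, $d\geq 1$, and let $H=\begin{bmatrix}\mathrm{Id}_n\\ H_{\mathrm{sub}}\end{bmatrix}$ be a known $m\times n$ real matrix, where $H_{\mathrm{sub}}$ is any $(m-n)\times n$ real matrix. The data are random pairs $(\boldsymbol{x}_t,\boldsymbol{y}_t)$, $1\leq t\leq T+1$, with features $\boldsymbol{x}_t\in\mathbb{R}^d$ and observations $\boldsymbol{y}_t=(y_{t,1},\ldots,y_{t,m})^\top\in\mathbb{R}^m$, where all observations are hierarchical (coherent): $\boldsymbol{y}_t=H\,(y_{t,1},\ldots,y_{t,n})^\top$, i.e., $\boldsymbol{y}_t\in\mathrm{Im}(H)$. Probabilities are with respect to all the data, i.e., both $(\boldsymbol{x}_{T+1},\boldsymbol{y}_{T+1})$ and $(\boldsymbol{x}_t,\boldsymbol{y}_t)_{1\leq t\leq T}$. Procedure: the set $\{1,\ldots,T\}$ is partitioned into three subsets $\mathcal{D}_{\mathrm{train}},\mathcal{D}_{\mathrm{estim}},\mathcal{D}_{\mathrm{calib}}$; let $T_{\mathrm{calib}}$ be the cardinality of $\mathcal{D}_{\mathrm{calib}}$. (1) A regression algorithm $\mathcal{A}$ (treated as a black box) outputs a regressor $\widehat{\boldsymbol{\mu}}:\mathbb{R}^d\to\mathbb{R}^m$ based on $(\boldsymbol{x}_t,\boldsymbol{y}_t)_{t\in\mathcal{D}_{\mathrm{train}}}$. (2) A function $\mathcal{P}$ with values given by $m\times m$ matrices provides $P=\mathcal{P}\bigl(\widehat{\boldsymbol{\mu}},(\boldsymbol{x}_t,\boldsymbol{y}_t)_{t\in\mathcal{D}_{\mathrm{estim}}}\bigr)$.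 Let $\widetilde{\boldsymbol{\mu}}(\cdot)=P\widehat{\boldsymbol{\mu}}(\cdot)=(\widetilde{\mu}_1(\cdot),\ldots,\widetilde{\mu}_m(\cdot))^\top$. (3) For $t\in\mathcal{D}_{\mathrm{calib}}$, compute the estimation errors (vector-valued signed non-conformity scores) $\widetilde{\boldsymbol{s}}_t=\boldsymbol{y}_t-\widetilde{\boldsymbol{\mu}}(\boldsymbol{x}_t)=(\widetilde{s}_{t,1},\ldots,\widetilde{s}_{t,m})^\top$; the score $\widetilde{\boldsymbol{s}}_{T+1}$ is defined by the same formula with $t=T+1$. (4) For each $i\in\{1,\ldots,m\}$, order $(\widetilde{s}_{t,i})_{t\in\mathcal{D}_{\mathrm{calib}}}$ into $\widetilde{s}_{(1),i}\leq\cdots\leq\widetilde{s}_{(T_{\mathrm{calib}}),i}$ and set $\widetilde{s}_{(0),i}=-\infty$, $\widetilde{s}_{(T_{\mathrm{calib}}+1),i}=+\infty$. (5) The output prediction intervals are $\widetilde{C}_i(\boldsymbol{x}_{T+1})$, where $$\widetilde{C}_i(\boldsymbol{x})=\Bigl[\widetilde{\mu}_i(\boldsymbol{x})+\widetilde{s}_{(\lfloor (T_{\mathrm{calib}}+1)\alpha/2\rfloor),i}\,,\ \widetilde{\mu}_i(\boldsymbol{x})+\widetilde{s}_{(\lceil (T_{\mathrm{calib}}+1)(1-\alpha/2)\rceil),i}\Bigr].$$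
   Formalization: The residuals are assumed i.i.d. conditionally on the data in D_train and D_estim (plain i.i.d. neither suffices nor follows from i.i.d. data), and "almost surely distinct" means that, for every component i, the scores s̃_{t,i} are pairwise distinct. *)

theory Defs
  imports "HOL-Probability.Probability"
begin

(* Indexing \<real>^m by the sum type 'n + 'k, with m = CARD('n) + CARD('k), makes the first n
   coordinates those of the form Inl j; since types are nonempty, n < m holds automatically. *)
definition hier_matrix ::
  "real^('n::finite)^('k::finite) \<Rightarrow> real^'n^('n + 'k)" where
  "hier_matrix Hsub =
     (\<chi> i j. case i of Inl a \<Rightarrow> (if a = j then 1 else 0) | Inr b \<Rightarrow> Hsub $ b $ j)"

definition sample ::
  "(nat \<Rightarrow> 'w \<Rightarrow> 'x) \<Rightarrow> (nat \<Rightarrow> 'w \<Rightarrow> 'y) \<Rightarrow> nat set \<Rightarrow> 'w \<Rightarrow> nat \<Rightarrow> 'x \<times> 'y" where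
  "sample x y D \<omega> = (\<lambda>t\<in>D. (x t \<omega>, y t \<omega>))"

definition iid_vars :: "'w measure \<Rightarrow> 'b measure \<Rightarrow> (nat \<Rightarrow> 'w \<Rightarrow> 'b) \<Rightarrow> nat set \<Rightarrow> bool" where
  "iid_vars M N X I \<longleftrightarrow>
     prob_space.indep_vars M (\<lambda>_. N) X I \<and>
     (\<forall>s\<in>I. \<forall>t\<in>I. distr M N (X s) = distr M N (X t))"

definition cprob :: "'w measure \<Rightarrow> 'w measure \<Rightarrow> 'w set \<Rightarrow> 'w \<Rightarrow> real" where
  "cprob M F E = real_cond_exp M F (indicator E)"

text \<open>Independent and identically distributed conditionally on the sub-sigma-algebra \<open>F\<close> of \<open>M\<close>.\<close>

definition cond_iid_vars ::
  "'w measure \<Rightarrow> 'w measure \<Rightarrow> 'b measure \<Rightarrow> (nat \<Rightarrow> 'w \<Rightarrow> 'b) \<Rightarrow> nat set \<Rightarrow> bool" where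
  "cond_iid_vars M F N X I \<longleftrightarrow>
     (\<forall>t\<in>I. X t \<in> measurable M N) \<and>
     (\<forall>J B. J \<subseteq> I \<longrightarrow> finite J \<longrightarrow> (\<forall>t\<in>J. B t \<in> sets N) \<longrightarrow>
        (AE \<omega> in M. cprob M F {\<omega>' \<in> space M. \<forall>t\<in>J. X t \<omega>' \<in> B t} \<omega>
                   = (\<Prod>t\<in>J. cprob M F {\<omega>' \<in> space M. X t \<omega>' \<in> B t} \<omega>))) \<and>
     (\<forall>s\<in>I. \<forall>t\<in>I. \<forall>B\<in>sets N.
        (AE \<omega> in M. cprob M F {\<omega>' \<in> space M. X s \<omega>' \<in> B} \<omega>
                   = cprob M F {\<omega>' \<in> space M. X t \<omega>' \<in> B} \<omega>))"

definition sample_algebra ::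
  "'w measure \<Rightarrow> (nat \<Rightarrow> 'w \<Rightarrow> 'x::topological_space) \<Rightarrow> (nat \<Rightarrow> 'w \<Rightarrow> 'y::topological_space)
     \<Rightarrow> nat set \<Rightarrow> 'w measure" where
  "sample_algebra M x y D =
     vimage_algebra (space M) (sample x y D) (Pi\<^sub>M D (\<lambda>_. borel))"

text \<open>The \<open>k\<close>-th smallest value of the scores \<open>s t\<close>, \<open>t \<in> D\<close>, counted with multiplicity; the
  values at \<open>k = 0\<close> and \<open>k > card D\<close> are infinite by convention.\<close>

definition order_stat :: "nat set \<Rightarrow> (nat \<Rightarrow> real) \<Rightarrow> nat \<Rightarrow> ereal" where
  "order_stat D s k =
     (if k = 0 then - \<infinity>
      else if k > card D then \<infinity>
      else ereal (sort (map s (sorted_list_of_set D)) ! (k - 1)))"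

definition conformal_interval ::
  "real \<Rightarrow> nat set \<Rightarrow> (nat \<Rightarrow> real) \<Rightarrow> real \<Rightarrow> real set" where
  "conformal_interval \<alpha> D s c =
     {v. ereal c + order_stat D s (nat \<lfloor>real (card D + 1) * (\<alpha> / 2)\<rfloor>) \<le> ereal v \<and>
         ereal v \<le> ereal c + order_stat D s (nat \<lceil>real (card D + 1) * (1 - \<alpha> / 2)\<rceil>)}"

end

theory Submission
  imports Defs
begin

text \<open>Since all observations lie in the image of \<open>H\<close> and \<open>P H = H\<close>, the scores satisfy
  \<open>stilde t = P *v shat t\<close>, where \<open>P\<close> depends only on the training and estimation
  data. Hence, if the residuals are i.i.d. conditionally on these data, every coordinate of the scores
  is an exchangeable family. The test point is covered iff the rank of its score among all
  \<open>N = card Dcalib + 1\<close> scores avoids the \<open>\<lfloor>N \<alpha>/2\<rfloor>\<close> lowest and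
  the \<open>N - \<lceil>N (1 - \<alpha>/2)\<rceil>\<close> highest positions. By exchangeability, \<open>N\<close> times the coverage
  probability is the expected number of indices whose score has such a rank, and this number is
  bounded deterministically.\<close>

section \<open>Order statistics expressed by counts\<close>

text \<open>In a sorted list the entries below \<open>v\<close> form an initial segment, so their
  number is the first position at which \<open>v\<close> is reached. Ties do no harm, and the dual
  statement \<open>sorted_nth_le_iff\<close> holds for the same reason.\<close>

lemma sorted_le_nth_iff:
  fixes xs :: "'a::linorder list"
  assumes "sorted xs" "k < length xs"
  shows "v \<le> xs ! k \<longleftrightarrow> length (filter (\<lambda>z. z < v) xs) \<le> k"
proof
  assume "v \<le> xs ! k"
  then have "{i. i < length xs \<and> xs ! i < v} \<subseteq> {..<k}"
    using assms by (auto simp: sorted_iff_nth_mono not_le[symmetric]) (meson order.trans leI)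
  from card_mono[OF _ this] show "length (filter (\<lambda>z. z < v) xs) \<le> k"
    by (simp add: length_filter_conv_card)
next
  assume le: "length (filter (\<lambda>z. z < v) xs) \<le> k"
  show "v \<le> xs ! k"
  proof (rule ccontr)
    assume "\<not> v \<le> xs ! k"
    then have "{..k} \<subseteq> {i. i < length xs \<and> xs ! i < v}"
      using assms by (auto simp: sorted_iff_nth_mono not_le intro: le_less_trans)
    from card_mono[OF _ this] le show False
      by (simp add: length_filter_conv_card)
  qed
qed

lemma sorted_nth_le_iff:
  fixes xs :: "'a::linorder list"
  assumes "sorted xs" "k < length xs"
  shows "xs ! k \<le> v \<longleftrightarrow> k < length (filter (\<lambda>z. z \<le> v) xs)"
proof
  assume "xs ! k \<le> v"
  then have "{..k} \<subseteq> {i. i < length xs \<and> xs ! i \<le> v}"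
    using assms by (auto simp: sorted_iff_nth_mono intro: order.trans)
  from card_mono[OF _ this] show "k < length (filter (\<lambda>z. z \<le> v) xs)"
    by (simp add: length_filter_conv_card)
next
  assume less: "k < length (filter (\<lambda>z. z \<le> v) xs)"
  show "xs ! k \<le> v"
  proof (rule ccontr)
    assume "\<not> xs ! k \<le> v"
    then have "{i. i < length xs \<and> xs ! i \<le> v} \<subseteq> {..<k}"
      using assms by (auto simp: sorted_iff_nth_mono) (meson order.trans leI)
    from card_mono[OF _ this] less show False
      by (simp add: length_filter_conv_card)
  qed
qed

lemma length_filter_sort_map:
  assumes "finite D"
  shows "length (filter P (sort (map s (sorted_list_of_set D)))) = card {t \<in> D. P (s t)}"
proof -
  have "length (filter P (sort (map s (sorted_list_of_set D))))
      = size (filter_mset P (mset (map s (sorted_list_of_set D))))"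
    by (metis mset_filter mset_sort size_mset)
  also have "\<dots> = length (filter (\<lambda>t. P (s t)) (sorted_list_of_set D))"
    by (metis (no_types, lifting) comp_apply filter_cong filter_map length_map mset_filter size_mset)
  also have "\<dots> = card {t \<in> D. P (s t)}"
    using assms distinct_card[OF distinct_filter[of "sorted_list_of_set D" "\<lambda>t. P (s t)"]] by simp
  finally show ?thesis .
qed

text \<open>The infinite conventions make the equivalence uniform in \<open>k\<close>: for
  \<open>k = 0\<close> both sides are false, and for \<open>k > card D\<close> both are true, since
  a count never exceeds \<open>card D\<close>. In the companion \<open>order_stat_le_iff\<close> the
  two truth values are exchanged.\<close>

lemma le_order_stat_iff:
  assumes "finite D"
  shows "ereal v \<le> order_stat D s k \<longleftrightarrow> card {t \<in> D. s t < v} < k"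
proof -
  have "card {t \<in> D. s t < v} \<le> card D"
    using assms by (intro card_mono) auto
  moreover have "k - 1 < length (sort (map s (sorted_list_of_set D)))" if "k \<noteq> 0" "k \<le> card D"
    using that by simp
  ultimately show ?thesis
    using assms
    by (auto simp: order_stat_def sorted_le_nth_iff length_filter_sort_map)
qed

lemma order_stat_le_iff:
  assumes "finite D"
  shows "order_stat D s k \<le> ereal v \<longleftrightarrow> k \<le> card {t \<in> D. s t \<le> v}"
proof -
  have "card {t \<in> D. s t \<le> v} \<le> card D"
    using assms by (intro card_mono) auto
  moreover have "k - 1 < length (sort (map s (sorted_list_of_set D)))" if "k \<noteq> 0" "k \<le> card D"
    using that by simp
  ultimately show ?thesis
    using assms
    by (auto simp: order_stat_def sorted_nth_le_iff length_filter_sort_map)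
qed

text \<open>The interval is built from \<open>D\<close> alone, whereas exchangeability concerns
  \<open>insert \<tau> D\<close>, so coverage is rewritten with ranks in the larger set. Adding
  \<tau> leaves the strict count unchanged and raises the weak count by one, which turns the lower
  condition from \<le> into a strict inequality.\<close>

lemma mem_conformal_interval_iff:
  assumes "finite D" "\<tau> \<notin> D"
  shows "c + s \<tau> \<in> conformal_interval \<alpha> D s c \<longleftrightarrow>
    card {t \<in> insert \<tau> D. s t < s \<tau>} < nat \<lceil>real (card D + 1) * (1 - \<alpha> / 2)\<rceil> \<and>
    nat \<lfloor>real (card D + 1) * (\<alpha> / 2)\<rfloor> < card {t \<in> insert \<tau> D. s t \<le> s \<tau>}"
proof -
  \<comment> \<open>The shift \<open>c\<close> is finite, so it cancels even when the endpoint
    \<open>e\<close> is infinite.\<close>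
  have shift: "ereal c + e \<le> ereal (c + v) \<longleftrightarrow> e \<le> ereal v"
    "ereal (c + v) \<le> ereal c + e \<longleftrightarrow> ereal v \<le> e" for e v
    by (cases e; simp)+
  have "{t \<in> insert \<tau> D. s t < s \<tau>} = {t \<in> D. s t < s \<tau>}"
    by auto
  moreover have "card {t \<in> insert \<tau> D. s t \<le> s \<tau>} = Suc (card {t \<in> D. s t \<le> s \<tau>})"
  proof -
    have "{t \<in> insert \<tau> D. s t \<le> s \<tau>} = insert \<tau> {t \<in> D. s t \<le> s \<tau>}"
      by auto
    then show ?thesis
      using assms by simp
  qed
  ultimately show ?thesis
    using assms(1)
    by (auto simp: conformal_interval_def shift le_order_stat_iff order_stat_le_iff less_Suc_eq_le)
qed

section \<open>Deterministic bounds on the number of indices with a given rank\<close>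

text \<open>In the next two lemmas the set is compared with the rank of its lowest, respectively highest,
  element; this also works with ties.\<close>

lemma card_rank_ge:
  fixes s :: "'i \<Rightarrow> 'a::linorder"
  assumes "finite I" "k \<le> card I"
  shows "card {\<tau> \<in> I. k \<le> card {t \<in> I. s t < s \<tau>}} \<le> card I - k"
proof (cases "{\<tau> \<in> I. k \<le> card {t \<in> I. s t < s \<tau>}} = {}")
  case False
  let ?S = "{\<tau> \<in> I. k \<le> card {t \<in> I. s t < s \<tau>}}"
  have "Min (s ` ?S) \<in> s ` ?S"
    using False assms by (intro Min_in) auto
  then obtain \<tau> where \<tau>: "\<tau> \<in> ?S" "s \<tau> = Min (s ` ?S)"
    by (metis (no_types, lifting) imageE)
  then have \<tau>_le: "s \<tau> \<le> s \<sigma>" if "\<sigma> \<in> ?S" for \<sigma>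
    using that assms by simp
  have "card ?S \<le> card (I - {t \<in> I. s t < s \<tau>})"
  proof (intro card_mono subsetI)
    fix \<sigma> assume "\<sigma> \<in> ?S"
    then show "\<sigma> \<in> I - {t \<in> I. s t < s \<tau>}"
      using \<tau>_le[of \<sigma>] by auto
  qed (use assms(1) in simp)
  also have "\<dots> = card I - card {t \<in> I. s t < s \<tau>}"
    using assms(1) by (intro card_Diff_subset) auto
  also have "\<dots> \<le> card I - k"
    using \<tau>(1) by auto
  finally show ?thesis .
qed (metis card.empty le0)

lemma card_rank_le:
  fixes s :: "'i \<Rightarrow> 'a::linorder"
  assumes "finite I"
  shows "card {\<tau> \<in> I. card {t \<in> I. s t \<le> s \<tau>} \<le> k} \<le> k"
proof (cases "{\<tau> \<in> I. card {t \<in> I. s t \<le> s \<tau>} \<le> k} = {}")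
  case False
  let ?S = "{\<tau> \<in> I. card {t \<in> I. s t \<le> s \<tau>} \<le> k}"
  have "Max (s ` ?S) \<in> s ` ?S"
    using False assms by (intro Max_in) auto
  then obtain \<tau> where \<tau>: "\<tau> \<in> ?S" "s \<tau> = Max (s ` ?S)"
    by (metis (no_types, lifting) imageE)
  then have "s \<sigma> \<le> s \<tau>" if "\<sigma> \<in> ?S" for \<sigma>
    using that assms by simp
  then have "card ?S \<le> card {t \<in> I. s t \<le> s \<tau>}"
    using assms by (intro card_mono) auto
  also have "\<dots> \<le> k"
    using \<tau>(1) by simp
  finally show ?thesis .
qed (metis card.empty le0)

text \<open>The indices that fail are covered by the at most \<open>card I - u\<close> ones of too
  high rank and the at most \<open>l\<close> ones of too low rank. The bound is stated over the
  integers because \<open>u - l\<close> may be negative.\<close>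

lemma card_rank_between_ge:
  fixes s :: "'i \<Rightarrow> 'a::linorder"
  assumes "finite I" "u \<le> card I"
  shows "int u - int l \<le> int (card {\<tau> \<in> I. card {t \<in> I. s t < s \<tau>} < u \<and> l < card {t \<in> I. s t \<le> s \<tau>}})"
    (is "_ \<le> int (card ?E)")
proof -
  let ?U = "{\<tau> \<in> I. u \<le> card {t \<in> I. s t < s \<tau>}}" and ?L = "{\<tau> \<in> I. card {t \<in> I. s t \<le> s \<tau>} \<le> l}"
  have "I = ?E \<union> (?U \<union> ?L)"
    by auto
  then have "card I \<le> card ?E + (card ?U + card ?L)"
    by (metis (no_types, lifting) add_left_mono card_Un_le order.trans)
  with card_rank_ge[OF assms, of s] card_rank_le[OF assms(1), of s l] assms(2) show ?thesis
    by linarith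
qed

text \<open>Without ties the weak rank is the strict rank plus one, and the strict rank is
  injective. The set therefore embeds into \<open>{l..<u}\<close>.\<close>

lemma card_rank_between_le:
  fixes s :: "'i \<Rightarrow> 'a::linorder"
  assumes "finite I" "inj_on s I"
  shows "card {\<tau> \<in> I. card {t \<in> I. s t < s \<tau>} < u \<and> l < card {t \<in> I. s t \<le> s \<tau>}} \<le> u - l"
    (is "card ?E \<le> _")
proof -
  let ?r = "\<lambda>\<tau>. card {t \<in> I. s t < s \<tau>}"
  have le: "card {t \<in> I. s t \<le> s \<tau>} = Suc (?r \<tau>)" if "\<tau> \<in> I" for \<tau>
  proof -
    have "{t \<in> I. s t \<le> s \<tau>} = insert \<tau> {t \<in> I. s t < s \<tau>}"
      using that assms(2) by (auto simp: less_le dest: inj_onD)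
    then show ?thesis
      using assms(1) by simp
  qed
  have mono: "?r \<tau> < ?r \<sigma>" if "\<tau> \<in> I" "s \<tau> < s \<sigma>" for \<tau> \<sigma>
    using that assms(1) by (intro psubset_card_mono) auto
  have "inj_on ?r ?E"
  proof (rule inj_onI)
    fix \<tau> \<sigma> assume *: "\<tau> \<in> ?E" "\<sigma> \<in> ?E" "?r \<tau> = ?r \<sigma>"
    then have "s \<tau> = s \<sigma>"
      using mono[of \<tau> \<sigma>] mono[of \<sigma> \<tau>] by (cases "s \<tau>" "s \<sigma>" rule: linorder_cases) auto
    then show "\<tau> = \<sigma>"
      using * assms(2) by (auto dest: inj_onD)
  qed
  then have "card ?E = card (?r ` ?E)"
    by (simp add: card_image)
  also have "\<dots> \<le> card {l..<u}"
    by (intro card_mono) (auto simp: le)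
  finally show ?thesis
    by simp
qed

section \<open>Conditioning on an independent variable\<close>

lemma subalgebra_vimage_algebra:
  assumes "V \<in> measurable M N"
  shows "subalgebra M (vimage_algebra (space M) V N)"
proof -
  have "V \<in> space M \<rightarrow> space N"
    using assms by (auto dest: measurable_space)
  then show ?thesis
    using assms by (auto simp: subalgebra_def sets_vimage_algebra2 measurable_sets)
qed

text \<open>The freezing principle: given \<open>V\<close>, an independent \<open>W\<close> keeps
  its law, so \<open>V\<close> may be held at its observed value while \<open>W\<close> is
  integrated out. The candidate is checked against the defining property of conditional expectation,
  with Tonelli on the product law.\<close>

lemma (in prob_space) cprob_indep_var:
  assumes indep: "indep_var N1 V N2 W" and S: "S \<in> sets (N1 \<Otimes>\<^sub>M N2)"
  shows "AE \<omega> in M. cprob M (vimage_algebra (space M) V N1) {\<omega>' \<in> space M. (V \<omega>', W \<omega>') \<in> S} \<omega>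
           = measure (distr M N2 W) (Pair (V \<omega>) -` S)"
proof -
  let ?F = "vimage_algebra (space M) V N1" and ?E = "{\<omega>' \<in> space M. (V \<omega>', W \<omega>') \<in> S}"
  let ?g = "\<lambda>\<omega>. measure (distr M N2 W) (Pair (V \<omega>) -` S)"
  have V[measurable]: "V \<in> measurable M N1" and W[measurable]: "W \<in> measurable M N2"
    using indep by (auto dest: indep_var_rv1 indep_var_rv2)
  have sub: "subalgebra M ?F"
    using V by (rule subalgebra_vimage_algebra)
  interpret F: finite_measure_subalgebra M ?F
    by unfold_locales (rule sub)
  interpret W: prob_space "distr M N2 W"
    by (rule prob_space_distr) fact
  have joint: "distr M N1 V \<Otimes>\<^sub>M distr M N2 W = distr M (N1 \<Otimes>\<^sub>M N2) (\<lambda>\<omega>. (V \<omega>, W \<omega>))"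
    using indep by (simp add: indep_var_distribution_eq)
  note S[measurable]
  have E: "?E \<in> sets M"
    by measurable
  have kern: "(\<lambda>v. measure (distr M N2 W) (Pair v -` S)) \<in> borel_measurable N1"
    unfolding measure_def by (intro borel_measurable_enn2real W.measurable_emeasure_Pair) simp
  have V_F: "V \<in> measurable ?F N1"
    using measurable_space[OF V] by (intro measurable_vimage_algebra1) auto
  have g_F: "?g \<in> borel_measurable ?F"
    using measurable_compose[OF V_F kern] .
  have g_M[measurable]: "?g \<in> borel_measurable M"
    using measurable_compose[OF V kern] .
  have g_int: "integrable M ?g"
    by (rule integrable_const_bound[where B=1]) auto
  have "set_lebesgue_integral M A (indicator ?E) = set_lebesgue_integral M A ?g" if A: "A \<in> sets ?F" for A
  proof -
    obtain a where a[measurable]: "a \<in> sets N1" and A_def: "A = V -` a \<inter> space M"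
      using A measurable_space[OF V] by (auto simp: sets_vimage_algebra2)
    have A_M[measurable]: "A \<in> sets M"
      unfolding A_def by measurable
    \<comment> \<open>Cutting \<open>S\<close> down to the cylinder over \<open>a\<close> absorbs
      the indicator of \<open>A\<close>: the section at \<open>V \<omega>\<close> is that of
      \<open>S\<close> when \<omega> lies in \<open>A\<close>, and empty otherwise.\<close>
    let ?S = "S \<inter> a \<times> space N2"
    have "ennreal (set_lebesgue_integral M A ?g) = (\<integral>\<^sup>+\<omega>. ennreal (indicator A \<omega> * ?g \<omega>) \<partial>M)"
      unfolding set_lebesgue_integral_def real_scaleR_def
      by (rule nn_integral_eq_integral[symmetric]) (auto intro!: integrable_const_bound[where B=1] mult_le_one simp: indicator_def)
    also have "\<dots> = (\<integral>\<^sup>+\<omega>. emeasure (distr M N2 W) (Pair (V \<omega>) -` ?S) \<partial>M)"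
    proof (rule nn_integral_cong)
      fix \<omega> assume \<omega>: "\<omega> \<in> space M"
      have "Pair (V \<omega>) -` ?S = (if \<omega> \<in> A then Pair (V \<omega>) -` S else {})"
        using \<omega> sets.sets_into_space[OF S] by (auto simp: A_def space_pair_measure)
      then show "ennreal (indicator A \<omega> * ?g \<omega>) = emeasure (distr M N2 W) (Pair (V \<omega>) -` ?S)"
        by (simp add: W.emeasure_eq_measure)
    qed
    also have "\<dots> = (\<integral>\<^sup>+v. emeasure (distr M N2 W) (Pair v -` ?S) \<partial>distr M N1 V)"
    proof (rule nn_integral_distr[symmetric])
      have "?S \<in> sets (N1 \<Otimes>\<^sub>M distr M N2 W)"
        by simp
      from W.measurable_emeasure_Pair[OF this]
      show "(\<lambda>v. emeasure (distr M N2 W) (Pair v -` ?S)) \<in> borel_measurable (distr M N1 V)"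
        unfolding measurable_distr_eq1 .
    qed (rule V)
    also have "\<dots> = emeasure (distr M N1 V \<Otimes>\<^sub>M distr M N2 W) ?S"
      by (rule W.emeasure_pair_measure_alt[symmetric]) (simp add: S)
    also have "\<dots> = emeasure M (A \<inter> ?E)"
      unfolding joint using measurable_space[OF W]
      by (subst emeasure_distr) (auto simp: A_def intro!: arg_cong[where f="emeasure M"])
    also have "\<dots> = ennreal (set_lebesgue_integral M A (indicator ?E))"
      unfolding set_lebesgue_integral_def using E
      by (simp add: emeasure_eq_measure flip: indicator_inter_arith)
    finally show ?thesis
      by (subst (asm) ennreal_inj) (auto simp: set_lebesgue_integral_def intro!: integral_nonneg_AE)
  qed
  moreover have "integrable M (indicator ?E :: _ \<Rightarrow> real)"
    using E by (simp add: emeasure_eq_measure)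
  ultimately show ?thesis
    unfolding cprob_def using g_int g_F by (intro F.real_cond_exp_charact) auto
qed

text \<open>Once \<open>V\<close> is frozen, the variables are images of the i.i.d.
  \<open>Z t\<close> under one fixed map. This is how residuals of i.i.d. data become conditionally
  i.i.d. although they all share the same random regressor.\<close>

lemma (in prob_space) cond_iid_vars_of_indep:
  assumes I: "finite I" "I \<noteq> {}"
    and iid: "iid_vars M N2 Z I"
    and indep: "indep_var N1 V (Pi\<^sub>M I (\<lambda>_. N2)) (\<lambda>\<omega>. \<lambda>t\<in>I. Z t \<omega>)"
    and g[measurable]: "g \<in> measurable (N1 \<Otimes>\<^sub>M N2) N"
  shows "cond_iid_vars M (vimage_algebra (space M) V N1) N (\<lambda>t \<omega>. g (V \<omega>, Z t \<omega>)) I"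
proof -
  let ?F = "vimage_algebra (space M) V N1"
  obtain t0 where t0: "t0 \<in> I"
    using I by auto
  define \<mu> where "\<mu> = distr M N2 (Z t0)"
  \<comment> \<open>The common conditional law given \<open>V\<close>. It does not mention
    \<open>t\<close>, and this yields identical distribution.\<close>
  define \<kappa> where "\<kappa> \<omega> b = measure \<mu> {z \<in> space N2. g (V \<omega>, z) \<in> b}" for \<omega> b
  have indepZ: "indep_vars (\<lambda>_. N2) Z I"
    using iid by (simp add: iid_vars_def)
  have Z[measurable]: "Z t \<in> measurable M N2" if "t \<in> I" for t
    using indepZ that by (auto simp: indep_vars_def)
  have V[measurable]: "V \<in> measurable M N1"
    using indep by (rule indep_var_rv1)
  interpret mu1: prob_space \<mu>
    unfolding \<mu>_def using t0 by (intro prob_space_distr) simp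
  interpret mu: finite_product_prob_space "\<lambda>_. \<mu>" I
    by standard (rule I)
  have [measurable_cong]: "sets \<mu> = sets N2" and space_\<mu>[simp]: "space \<mu> = space N2"
    by (simp_all add: \<mu>_def)
  have "distr M (\<Pi>\<^sub>M t\<in>I. N2) (\<lambda>\<omega>. \<lambda>t\<in>I. Z t \<omega>) = (\<Pi>\<^sub>M t\<in>I. distr M N2 (Z t))"
    using indepZ I(2) by (subst (asm) indep_vars_iff_distr_eq_PiM') auto
  also have "\<dots> = (\<Pi>\<^sub>M t\<in>I. \<mu>)"
  proof (intro PiM_cong refl)
    fix t assume "t \<in> I"
    then show "distr M N2 (Z t) = \<mu>"
      using iid t0 unfolding \<mu>_def iid_vars_def by blast
  qed
  finally have law: "distr M (\<Pi>\<^sub>M t\<in>I. N2) (\<lambda>\<omega>. \<lambda>t\<in>I. Z t \<omega>) = (\<Pi>\<^sub>M t\<in>I. \<mu>)" .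
  \<comment> \<open>The whole index set comes first, because the independence from \<open>V\<close>
    is assumed for the complete family.\<close>
  have full: "AE \<omega> in M. cprob M ?F {\<omega>' \<in> space M. \<forall>t\<in>I. g (V \<omega>', Z t \<omega>') \<in> B t} \<omega> = (\<Prod>t\<in>I. \<kappa> \<omega> (B t))"
    if B[measurable]: "\<And>t. t \<in> I \<Longrightarrow> B t \<in> sets N" for B
  proof -
    define S where "S = {p \<in> space (N1 \<Otimes>\<^sub>M (\<Pi>\<^sub>M t\<in>I. N2)). \<forall>t\<in>I. g (fst p, snd p t) \<in> B t}"
    have S: "S \<in> sets (N1 \<Otimes>\<^sub>M (\<Pi>\<^sub>M t\<in>I. N2))"
      unfolding S_def using I(1) by measurable
    have "{\<omega>' \<in> space M. \<forall>t\<in>I. g (V \<omega>', Z t \<omega>') \<in> B t}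
        = {\<omega>' \<in> space M. (V \<omega>', \<lambda>t\<in>I. Z t \<omega>') \<in> S}"
      using measurable_space[OF V] measurable_space[OF Z]
      by (auto simp: S_def space_pair_measure space_PiM)
    moreover have "measure (\<Pi>\<^sub>M t\<in>I. \<mu>) (Pair (V \<omega>) -` S) = (\<Prod>t\<in>I. \<kappa> \<omega> (B t))" if \<omega>: "\<omega> \<in> space M" for \<omega>
    proof -
      have V\<omega>: "V \<omega> \<in> space N1"
        using \<omega> V by (rule measurable_space[rotated])
      \<comment> \<open>For a frozen \<open>V\<close> the section is a box, so the product measure
        factorizes over it.\<close>
      have "Pair (V \<omega>) -` S = (\<Pi>\<^sub>E t\<in>I. {z \<in> space N2. g (V \<omega>, z) \<in> B t})"
        using V\<omega> by (auto simp: S_def space_pair_measure space_PiM PiE_iff dest: extensional_arb)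
      moreover have "{z \<in> space N2. g (V \<omega>, z) \<in> B t} \<in> sets \<mu>" if "t \<in> I" for t
        using V\<omega> that by measurable
      ultimately show ?thesis
        by (simp add: mu.prob_times \<kappa>_def)
    qed
    ultimately show ?thesis
      using cprob_indep_var[OF indep S] unfolding law by auto
  qed
  have sub: "AE \<omega> in M. cprob M ?F {\<omega>' \<in> space M. \<forall>t\<in>J. g (V \<omega>', Z t \<omega>') \<in> B t} \<omega> = (\<Prod>t\<in>J. \<kappa> \<omega> (B t))"
    if J: "J \<subseteq> I" and B: "\<And>t. t \<in> J \<Longrightarrow> B t \<in> sets N" for J B
  proof -
    \<comment> \<open>Indices outside \<open>J\<close> receive the trivial constraint
      \<open>space N\<close>, which contributes the factor 1.\<close>
    let ?B = "\<lambda>t. if t \<in> J then B t else space N"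
    have gsp: "g (V \<omega>, z) \<in> space N" if "\<omega> \<in> space M" "z \<in> space N2" for \<omega> z
      using that measurable_space[OF V] by (intro measurable_space[OF g]) (auto simp: space_pair_measure)
    have "{\<omega>' \<in> space M. \<forall>t\<in>I. g (V \<omega>', Z t \<omega>') \<in> ?B t} = {\<omega>' \<in> space M. \<forall>t\<in>J. g (V \<omega>', Z t \<omega>') \<in> B t}"
      using J gsp measurable_space[OF Z] by auto
    moreover have "(\<Prod>t\<in>I. \<kappa> \<omega> (?B t)) = (\<Prod>t\<in>J. \<kappa> \<omega> (B t))" if "\<omega> \<in> space M" for \<omega>
    proof -
      have "\<kappa> \<omega> (space N) = 1"
        using gsp[OF that] mu1.prob_space by (simp add: \<kappa>_def cong: conj_cong)
      then show ?thesis
        using J I(1) by (intro prod.mono_neutral_cong_right) auto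
    qed
    ultimately show ?thesis
      using full[of ?B] B by auto
  qed
  have single: "AE \<omega> in M. cprob M ?F {\<omega>' \<in> space M. g (V \<omega>', Z t \<omega>') \<in> b} \<omega> = \<kappa> \<omega> b"
    if "t \<in> I" "b \<in> sets N" for t b
    using sub[of "{t}" "\<lambda>_. b"] that by simp
  show ?thesis
    unfolding cond_iid_vars_def
  proof (intro conjI allI impI ballI)
    fix t assume "t \<in> I"
    then show "(\<lambda>\<omega>. g (V \<omega>, Z t \<omega>)) \<in> measurable M N"
      by measurable
  next
    fix J B assume J: "J \<subseteq> I" "finite J" and B: "\<forall>t\<in>J. B t \<in> sets N"
    have "AE \<omega> in M. \<forall>t\<in>J. cprob M ?F {\<omega>' \<in> space M. g (V \<omega>', Z t \<omega>') \<in> B t} \<omega> = \<kappa> \<omega> (B t)"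
      using J B single by (intro AE_finite_allI) auto
    moreover have "AE \<omega> in M. cprob M ?F {\<omega>' \<in> space M. \<forall>t\<in>J. g (V \<omega>', Z t \<omega>') \<in> B t} \<omega> = (\<Prod>t\<in>J. \<kappa> \<omega> (B t))"
      using J B by (intro sub) auto
    ultimately show "AE \<omega> in M. cprob M ?F {\<omega>' \<in> space M. \<forall>t\<in>J. g (V \<omega>', Z t \<omega>') \<in> B t} \<omega>
        = (\<Prod>t\<in>J. cprob M ?F {\<omega>' \<in> space M. g (V \<omega>', Z t \<omega>') \<in> B t} \<omega>)"
      by eventually_elim simp
  next
    fix s t b assume "s \<in> I" "t \<in> I" "b \<in> sets N"
    with single[of s b] single[of t b] show "AE \<omega> in M. cprob M ?F {\<omega>' \<in> space M. g (V \<omega>', Z s \<omega>') \<in> b} \<omega>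
        = cprob M ?F {\<omega>' \<in> space M. g (V \<omega>', Z t \<omega>') \<in> b} \<omega>"
      by auto
  qed
qed

section \<open>From conditional i.i.d. to exchangeability\<close>

text \<open>Measurable rectangles are stable under intersection and generate the product
  sigma-algebra. As \<open>P\<close> is finite, the constant sequence of the whole space serves as
  the exhaustion.\<close>

lemma measure_eqI_pair_finite:
  assumes P: "sets P = sets (A \<Otimes>\<^sub>M B)" and Q: "sets Q = sets (A \<Otimes>\<^sub>M B)"
    and fin: "finite_measure P"
    and eq: "\<And>a b. a \<in> sets A \<Longrightarrow> b \<in> sets B \<Longrightarrow> emeasure P (a \<times> b) = emeasure Q (a \<times> b)"
  shows "P = Q"
proof (rule measure_eqI_generator_eq[OF Int_stable_pair_measure_generator[of A B],
      where A="\<lambda>_. space A \<times> space B" and \<Omega>="space A \<times> space B"])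
  show "emeasure P (space A \<times> space B) \<noteq> \<infinity>"
    using fin by (simp add: finite_measure.emeasure_finite)
  show "{a \<times> b | a b. a \<in> sets A \<and> b \<in> sets B} \<subseteq> Pow (space A \<times> space B)"
    by (auto dest: sets.sets_into_space)
  show "sets P = sigma_sets (space A \<times> space B) {a \<times> b | a b. a \<in> sets A \<and> b \<in> sets B}"
    "sets Q = sigma_sets (space A \<times> space B) {a \<times> b | a b. a \<in> sets A \<and> b \<in> sets B}"
    using P Q by (simp_all only: sets_pair_measure)
qed (use eq in auto)

text \<open>Permuting the variables only permutes the factors of the conditional probability of a
  box. \<open>V\<close> is kept in the joint law because the scores are later formed from the
  residuals by a map that depends on \<open>V\<close>.\<close>

lemma (in prob_space) cond_iid_vars_distr_permute:
  assumes cond: "cond_iid_vars M (vimage_algebra (space M) V N1) N X I"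
    and V[measurable]: "V \<in> measurable M N1"
    and I: "finite I" and \<sigma>: "\<sigma> permutes I"
  shows "distr M (N1 \<Otimes>\<^sub>M (\<Pi>\<^sub>M t\<in>I. N)) (\<lambda>\<omega>. (V \<omega>, \<lambda>t\<in>I. X (\<sigma> t) \<omega>))
       = distr M (N1 \<Otimes>\<^sub>M (\<Pi>\<^sub>M t\<in>I. N)) (\<lambda>\<omega>. (V \<omega>, \<lambda>t\<in>I. X t \<omega>))"
proof -
  let ?F = "vimage_algebra (space M) V N1"
  let ?X = "\<lambda>\<omega>. \<lambda>t\<in>I. X t \<omega>" and ?Y = "\<lambda>\<omega>. \<lambda>t\<in>I. X (\<sigma> t) \<omega>"
  have \<sigma>_in[simp]: "\<sigma> t \<in> I \<longleftrightarrow> t \<in> I" for t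
    using \<sigma> by (rule permutes_in_image)
  have X[measurable]: "X t \<in> measurable M N" if "t \<in> I" for t
    using cond that by (auto simp: cond_iid_vars_def)
  have Xm[measurable]: "?X \<in> measurable M (\<Pi>\<^sub>M t\<in>I. N)" and Ym[measurable]: "?Y \<in> measurable M (\<Pi>\<^sub>M t\<in>I. N)"
    by (intro measurable_restrict; simp)+
  have sub: "subalgebra M ?F"
    using V by (rule subalgebra_vimage_algebra)
  interpret F: finite_measure_subalgebra M ?F
    by unfold_locales (rule sub)
  have prod: "AE \<omega> in M. cprob M ?F {\<omega>' \<in> space M. \<forall>t\<in>I. X t \<omega>' \<in> B t} \<omega>
      = (\<Prod>t\<in>I. cprob M ?F {\<omega>' \<in> space M. X t \<omega>' \<in> B t} \<omega>)" if "\<And>t. t \<in> I \<Longrightarrow> B t \<in> sets N" for B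
    using cond I that by (auto simp: cond_iid_vars_def)
  have same: "AE \<omega> in M. cprob M ?F {\<omega>' \<in> space M. X s \<omega>' \<in> b} \<omega> = cprob M ?F {\<omega>' \<in> space M. X t \<omega>' \<in> b} \<omega>"
    if "s \<in> I" "t \<in> I" "b \<in> sets N" for s t b
    using cond that unfolding cond_iid_vars_def by blast
  have rect: "prob (A \<inter> {\<omega> \<in> space M. \<forall>t\<in>I. X (\<sigma> t) \<omega> \<in> B t}) = prob (A \<inter> {\<omega> \<in> space M. \<forall>t\<in>I. X t \<omega> \<in> B t})"
    if A: "A \<in> sets ?F" and B[measurable]: "\<And>t. t \<in> I \<Longrightarrow> B t \<in> sets N" for A B
  proof -
    let ?E = "{\<omega> \<in> space M. \<forall>t\<in>I. X (\<sigma> t) \<omega> \<in> B t}" and ?E' = "{\<omega> \<in> space M. \<forall>t\<in>I. X t \<omega> \<in> B t}"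
    \<comment> \<open>The permutation is moved from the variables to the sets, so that the
      factorization, known for the family in its original order, applies.\<close>
    let ?B = "\<lambda>t. B (inv \<sigma> t)"
    have inv_in[simp]: "inv \<sigma> t \<in> I \<longleftrightarrow> t \<in> I" for t
      using permutes_inv[OF \<sigma>] by (rule permutes_in_image)
    have E_eq: "?E = {\<omega> \<in> space M. \<forall>t\<in>I. X t \<omega> \<in> ?B t}"
      using permutes_inverses[OF \<sigma>] inv_in \<sigma>_in by metis
    have E[measurable]: "?E \<in> sets M" and E'[measurable]: "?E' \<in> sets M"
      using I by measurable
    have "(\<Prod>t\<in>I. cprob M ?F {\<omega>' \<in> space M. X t \<omega>' \<in> ?B t} \<omega>)
        = (\<Prod>t\<in>I. cprob M ?F {\<omega>' \<in> space M. X (\<sigma> t) \<omega>' \<in> B t} \<omega>)" for \<omega>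
      by (subst prod.permute[OF \<sigma>]) (simp add: permutes_inverses[OF \<sigma>])
    then have "AE \<omega> in M. cprob M ?F ?E \<omega> = (\<Prod>t\<in>I. cprob M ?F {\<omega>' \<in> space M. X (\<sigma> t) \<omega>' \<in> B t} \<omega>)"
      using prod[of ?B] unfolding E_eq by simp
    moreover have "AE \<omega> in M. \<forall>t\<in>I. cprob M ?F {\<omega>' \<in> space M. X (\<sigma> t) \<omega>' \<in> B t} \<omega>
        = cprob M ?F {\<omega>' \<in> space M. X t \<omega>' \<in> B t} \<omega>"
      using I by (intro AE_finite_allI same) auto
    moreover have "AE \<omega> in M. cprob M ?F ?E' \<omega> = (\<Prod>t\<in>I. cprob M ?F {\<omega>' \<in> space M. X t \<omega>' \<in> B t} \<omega>)"
      by (intro prod) simp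
    ultimately have ae: "AE \<omega> in M. cprob M ?F ?E \<omega> = cprob M ?F ?E' \<omega>"
      by eventually_elim simp
    have A_M[measurable]: "A \<in> sets M"
      using A sub by (auto simp: subalgebra_def)
    \<comment> \<open>Averaging over sets \<open>A\<close> of the conditioning sigma-algebra turns
      the almost sure equality of conditional probabilities into an equality of
      probabilities.\<close>
    have prob_eq: "prob (A \<inter> G) = set_lebesgue_integral M A (cprob M ?F G)" if "G \<in> sets M" for G
    proof -
      have "prob (A \<inter> G) = set_lebesgue_integral M A (indicator G)"
        unfolding set_lebesgue_integral_def using that by (simp flip: indicator_inter_arith)
      also have "\<dots> = set_lebesgue_integral M A (cprob M ?F G)"
        unfolding cprob_def using that A by (intro F.real_cond_exp_intA) (auto simp: emeasure_eq_measure)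
      finally show ?thesis .
    qed
    have [measurable]: "cprob M ?F G \<in> borel_measurable M" for G
      unfolding cprob_def by (rule borel_measurable_cond_exp2)
    have "set_lebesgue_integral M A (cprob M ?F ?E) = set_lebesgue_integral M A (cprob M ?F ?E')"
      using ae by (intro set_lebesgue_integral_cong_AE) auto
    then show ?thesis
      by (simp only: prob_eq[OF E] prob_eq[OF E'])
  qed
  show ?thesis
  proof (rule measure_eqI_pair_finite)
    fix a b assume a[measurable]: "a \<in> sets N1" and b[measurable]: "b \<in> sets (\<Pi>\<^sub>M t\<in>I. N)"
    define A where "A = V -` a \<inter> space M"
    have A_F: "A \<in> sets ?F" and A_M[measurable]: "A \<in> sets M"
      using a by (auto simp: A_def in_vimage_algebra)
    \<comment> \<open>The law of \<open>Z\<close> on the event \<open>A\<close>. With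
      \<open>a\<close> fixed, these finite measures are compared on boxes, which extends the
      equality to every measurable \<open>b\<close>.\<close>
    let ?D = "\<lambda>Z. distr (density M (indicator A)) (\<Pi>\<^sub>M t\<in>I. N) Z"
    have D: "emeasure (?D Z) c = emeasure M (A \<inter> (Z -` c \<inter> space M))"
      if [measurable]: "Z \<in> measurable M (\<Pi>\<^sub>M t\<in>I. N)" and [measurable]: "c \<in> sets (\<Pi>\<^sub>M t\<in>I. N)" for Z c
      by (simp add: emeasure_distr emeasure_density flip: indicator_inter_arith)
    have "?D ?Y = ?D ?X"
    proof (rule measure_eqI_PiM_finite[OF I])
      fix B assume B: "\<And>t. t \<in> I \<Longrightarrow> B t \<in> sets N"
      then have "Pi\<^sub>E I B \<in> sets (\<Pi>\<^sub>M t\<in>I. N)"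
        using I by (intro sets_PiM_I_finite) auto
      moreover have "?Y -` Pi\<^sub>E I B \<inter> space M = {\<omega> \<in> space M. \<forall>t\<in>I. X (\<sigma> t) \<omega> \<in> B t}"
        "?X -` Pi\<^sub>E I B \<inter> space M = {\<omega> \<in> space M. \<forall>t\<in>I. X t \<omega> \<in> B t}"
        by (auto simp: PiE_iff)
      ultimately show "emeasure (?D ?Y) (Pi\<^sub>E I B) = emeasure (?D ?X) (Pi\<^sub>E I B)"
        using rect[OF A_F, of B] B by (simp add: D emeasure_eq_measure)
    next
      show "range (\<lambda>_::nat. space (\<Pi>\<^sub>M t\<in>I. N)) \<subseteq> prod_algebra I (\<lambda>_. N)"
        using I by (auto simp: space_PiM intro!: prod_algebraI_finite)
      show "emeasure (?D ?Y) (space (\<Pi>\<^sub>M t\<in>I. N)) \<noteq> \<infinity>"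
        by (simp add: D emeasure_eq_measure)
    qed auto
    then have "emeasure (?D ?Y) b = emeasure (?D ?X) b"
      by simp
    moreover have "emeasure (distr M (N1 \<Otimes>\<^sub>M (\<Pi>\<^sub>M t\<in>I. N)) (\<lambda>\<omega>. (V \<omega>, Z \<omega>))) (a \<times> b) = emeasure (?D Z) b"
      if [measurable]: "Z \<in> measurable M (\<Pi>\<^sub>M t\<in>I. N)" for Z
      unfolding D[OF that b] by (subst emeasure_distr) (auto simp: A_def intro!: arg_cong[where f="emeasure M"])
    ultimately show "emeasure (distr M (N1 \<Otimes>\<^sub>M (\<Pi>\<^sub>M t\<in>I. N)) (\<lambda>\<omega>. (V \<omega>, ?Y \<omega>))) (a \<times> b)
        = emeasure (distr M (N1 \<Otimes>\<^sub>M (\<Pi>\<^sub>M t\<in>I. N)) (\<lambda>\<omega>. (V \<omega>, ?X \<omega>))) (a \<times> b)"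
      by (simp only: Xm Ym)
  qed (auto intro!: finite_measure.finite_measure_distr finite_measure_axioms)
qed

definition exchangeable :: "'w measure \<Rightarrow> 'b measure \<Rightarrow> ('i \<Rightarrow> 'w \<Rightarrow> 'b) \<Rightarrow> 'i set \<Rightarrow> bool" where
  "exchangeable M N X I \<longleftrightarrow>
     (\<forall>t\<in>I. X t \<in> measurable M N) \<and>
     (\<forall>\<sigma>. \<sigma> permutes I \<longrightarrow>
        distr M (\<Pi>\<^sub>M t\<in>I. N) (\<lambda>\<omega>. \<lambda>t\<in>I. X (\<sigma> t) \<omega>) = distr M (\<Pi>\<^sub>M t\<in>I. N) (\<lambda>\<omega>. \<lambda>t\<in>I. X t \<omega>))"

text \<open>The same map \<open>h (V \<omega>, _)\<close> acts on every coordinate, so it commutes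
  with permutations. The permuted family is thus an image of the permuted joint law with
  \<open>V\<close>, which is already known to be invariant.\<close>

lemma (in prob_space) exchangeable_of_cond_iid:
  assumes cond: "cond_iid_vars M (vimage_algebra (space M) V N1) N X I"
    and V: "V \<in> measurable M N1"
    and I: "finite I"
    and h[measurable]: "h \<in> measurable (N1 \<Otimes>\<^sub>M N) K"
  shows "exchangeable M K (\<lambda>t \<omega>. h (V \<omega>, X t \<omega>)) I"
proof -
  note V[measurable]
  have X[measurable]: "X t \<in> measurable M N" if "t \<in> I" for t
    using cond that by (auto simp: cond_iid_vars_def)
  let ?N = "N1 \<Otimes>\<^sub>M (\<Pi>\<^sub>M t\<in>I. N)"
  let ?H = "\<lambda>p. \<lambda>t\<in>I. h (fst p, snd p t)"
  have H[measurable]: "?H \<in> measurable ?N (\<Pi>\<^sub>M t\<in>I. K)"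
    by (intro measurable_restrict) measurable
  have push: "distr M (\<Pi>\<^sub>M t\<in>I. K) (\<lambda>\<omega>. \<lambda>t\<in>I. h (V \<omega>, X (\<sigma> t) \<omega>))
      = distr (distr M ?N (\<lambda>\<omega>. (V \<omega>, \<lambda>t\<in>I. X (\<sigma> t) \<omega>))) (\<Pi>\<^sub>M t\<in>I. K) ?H"
    if \<sigma>: "\<sigma> permutes I" for \<sigma>
  proof -
    have "(\<lambda>\<omega>. \<lambda>t\<in>I. X (\<sigma> t) \<omega>) \<in> measurable M (\<Pi>\<^sub>M t\<in>I. N)"
      using permutes_in_image[OF \<sigma>] by (intro measurable_restrict) simp
    then show ?thesis
      by (subst distr_distr[OF H]) (auto simp: comp_def cong: restrict_cong)
  qed
  show ?thesis
    unfolding exchangeable_def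
  proof (intro conjI ballI allI impI)
    fix \<sigma> assume \<sigma>: "\<sigma> permutes I"
    show "distr M (\<Pi>\<^sub>M t\<in>I. K) (\<lambda>\<omega>. \<lambda>t\<in>I. h (V \<omega>, X (\<sigma> t) \<omega>))
        = distr M (\<Pi>\<^sub>M t\<in>I. K) (\<lambda>\<omega>. \<lambda>t\<in>I. h (V \<omega>, X t \<omega>))"
      \<comment> \<open>The unpermuted law is the case of the identity permutation.\<close>
      unfolding push[OF \<sigma>] cond_iid_vars_distr_permute[OF cond V I \<sigma>]
      using push[OF permutes_id] by simp
  qed measurable
qed

section \<open>Ranks of exchangeable scores and coverage\<close>

text \<open>Swapping \<tau> and \<sigma> carries \<open>E \<tau>\<close> to
  \<open>E \<sigma>\<close> without changing the law, so all these events are equally likely.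
  Summing their indicators gives the expected count.\<close>

lemma (in prob_space) exchangeable_prob_rank:
  fixes s :: "'i \<Rightarrow> 'a \<Rightarrow> real" and l u :: nat
  assumes ex: "exchangeable M borel s I" and I: "finite I" "\<tau> \<in> I"
  defines "E \<equiv> \<lambda>\<sigma>. {\<omega> \<in> space M. card {t \<in> I. s t \<omega> < s \<sigma> \<omega>} < u \<and> l < card {t \<in> I. s t \<omega> \<le> s \<sigma> \<omega>}}"
  shows "real (card I) * prob (E \<tau>) = expectation (\<lambda>\<omega>. real (card {\<sigma> \<in> I. \<omega> \<in> E \<sigma>}))"
    and "integrable M (\<lambda>\<omega>. real (card {\<sigma> \<in> I. \<omega> \<in> E \<sigma>}))"
proof -
  have s[measurable]: "s t \<in> borel_measurable M" if "t \<in> I" for t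
    using ex that by (auto simp: exchangeable_def)
  \<comment> \<open>As a finite sum, the cardinality has a measurability proof term by term.\<close>
  have card_sum: "card {t \<in> I. P t} = (\<Sum>t\<in>I. if P t then 1 else 0)" for P
    using I(1) by (simp add: sum.If_cases Int_def)
  let ?PiM = "\<Pi>\<^sub>M t\<in>I. (borel :: real measure)"
  define S where "S = {r \<in> space ?PiM. card {t \<in> I. r t < r \<tau>} < u \<and> l < card {t \<in> I. r t \<le> r \<tau>}}"
  have S[measurable]: "S \<in> sets ?PiM"
    unfolding S_def card_sum using I(2) by measurable
  have E[measurable]: "E \<sigma> \<in> events" if "\<sigma> \<in> I" for \<sigma>
    unfolding E_def card_sum using that by measurable
  have prob_E: "prob (E \<sigma>) = prob (E \<tau>)" if \<sigma>: "\<sigma> \<in> I" for \<sigma>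
  proof -
    let ?p = "Transposition.transpose \<tau> \<sigma>"
    have p: "?p permutes I"
      using \<sigma> I(2) by (intro permutes_swap_id)
    have p_in: "?p t \<in> I \<longleftrightarrow> t \<in> I" for t
      using p by (rule permutes_in_image)
    \<comment> \<open>Counts over all of \<open>I\<close> do not notice the relabelling; only the
      reference score changes.\<close>
    have bij: "card {t \<in> I. P (?p t)} = card {t \<in> I. P t}" for P
      by (intro bij_betw_same_card[of ?p] bij_betwI[of _ _ _ ?p]) (auto simp: p_in)
    have "E \<sigma> = (\<lambda>\<omega>. \<lambda>t\<in>I. s (?p t) \<omega>) -` S \<inter> space M"
      using I(2) bij[of "\<lambda>t. s t \<omega> < s \<sigma> \<omega>" for \<omega>] bij[of "\<lambda>t. s t \<omega> \<le> s \<sigma> \<omega>" for \<omega>]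
      by (auto simp: E_def S_def space_PiM cong: conj_cong)
    moreover have "(\<lambda>\<omega>. \<lambda>t\<in>I. s (?p t) \<omega>) \<in> measurable M ?PiM"
      by (intro measurable_restrict) (simp add: p_in)
    ultimately have "prob (E \<sigma>) = measure (distr M ?PiM (\<lambda>\<omega>. \<lambda>t\<in>I. s (?p t) \<omega>)) S"
      by (simp add: measure_distr)
    also have "\<dots> = measure (distr M ?PiM (\<lambda>\<omega>. \<lambda>t\<in>I. s t \<omega>)) S"
      using ex p by (simp add: exchangeable_def)
    also have "\<dots> = prob ((\<lambda>\<omega>. \<lambda>t\<in>I. s t \<omega>) -` S \<inter> space M)"
      by (intro measure_distr measurable_restrict) auto
    also have "(\<lambda>\<omega>. \<lambda>t\<in>I. s t \<omega>) -` S \<inter> space M = E \<tau>"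
      using I(2) by (auto simp: E_def S_def space_PiM cong: conj_cong)
    finally show ?thesis .
  qed
  have card_eq: "real (card {\<sigma> \<in> I. \<omega> \<in> E \<sigma>}) = (\<Sum>\<sigma>\<in>I. indicator (E \<sigma>) \<omega>)" for \<omega>
    by (auto simp: card_sum indicator_def intro!: sum.cong)
  have int: "integrable M (indicator (E \<sigma>) :: _ \<Rightarrow> real)" if "\<sigma> \<in> I" for \<sigma>
    using that by (simp add: emeasure_eq_measure)
  show "integrable M (\<lambda>\<omega>. real (card {\<sigma> \<in> I. \<omega> \<in> E \<sigma>}))"
    unfolding card_eq using int by (intro Bochner_Integration.integrable_sum)
  have "expectation (\<lambda>\<omega>. real (card {\<sigma> \<in> I. \<omega> \<in> E \<sigma>})) = (\<Sum>\<sigma>\<in>I. prob (E \<sigma>))"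
    unfolding card_eq using int E
    by (subst Bochner_Integration.integral_sum) (auto intro!: sum.cong)
  then show "real (card I) * prob (E \<tau>) = expectation (\<lambda>\<omega>. real (card {\<sigma> \<in> I. \<omega> \<in> E \<sigma>}))"
    using prob_E by simp
qed

text \<open>The centre \<open>c\<close> cancels, leaving a rank event. Dividing the deterministic
  bounds on the expected count by \<open>n\<close> gives both inequalities.\<close>

lemma (in prob_space) exchangeable_conformal_coverage:
  fixes s :: "nat \<Rightarrow> 'a \<Rightarrow> real" and c :: "'a \<Rightarrow> real"
  assumes ex: "exchangeable M borel s (insert \<tau> D)" and D: "finite D" "\<tau> \<notin> D"
    and \<alpha>: "0 < \<alpha>" "\<alpha> < 1"
  defines "E \<equiv> {\<omega> \<in> space M. c \<omega> + s \<tau> \<omega> \<in> conformal_interval \<alpha> D (\<lambda>t. s t \<omega>) (c \<omega>)}"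
  shows "1 - \<alpha> \<le> prob E"
    and "(AE \<omega> in M. inj_on (\<lambda>t. s t \<omega>) (insert \<tau> D)) \<Longrightarrow> prob E \<le> 1 - \<alpha> + 2 / (real (card D) + 1)"
proof -
  let ?I = "insert \<tau> D"
  define n where "n = real (card D + 1)"
  define l u where "l = nat \<lfloor>n * (\<alpha> / 2)\<rfloor>" and "u = nat \<lceil>n * (1 - \<alpha> / 2)\<rceil>"
  define R where "R \<sigma> = {\<omega> \<in> space M. card {t \<in> ?I. s t \<omega> < s \<sigma> \<omega>} < u \<and> l < card {t \<in> ?I. s t \<omega> \<le> s \<sigma> \<omega>}}" for \<sigma>
  define N where "N \<omega> = card {\<sigma> \<in> ?I. \<omega> \<in> R \<sigma>}" for \<omega>
  have n: "real (card ?I) = n" "0 < n"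
    using D by (simp_all add: n_def)
  have E: "E = R \<tau>"
    unfolding E_def R_def l_def u_def n_def
    using mem_conformal_interval_iff[OF D, where s="\<lambda>t. s t \<omega>" for \<omega>] by (intro Collect_cong) blast
  have prob_eq: "n * prob E = expectation (\<lambda>\<omega>. real (N \<omega>))" and int: "integrable M (\<lambda>\<omega>. real (N \<omega>))"
    unfolding E N_def n(1)[symmetric] R_def
    by (rule exchangeable_prob_rank[OF ex, where \<tau>=\<tau>]; use D in simp)+
  have N_eq: "N \<omega> = card {\<sigma> \<in> ?I. card {t \<in> ?I. s t \<omega> < s \<sigma> \<omega>} < u \<and> l < card {t \<in> ?I. s t \<omega> \<le> s \<sigma> \<omega>}}"
    if "\<omega> \<in> space M" for \<omega>
    using that by (simp add: N_def R_def)
  \<comment> \<open>Each rounding costs less than one, so \<open>u - l\<close> lies between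
    \<open>n * (1 - \<alpha>)\<close> and \<open>n * (1 - \<alpha>) + 2\<close>; this is the origin
    of the 2 in the upper bound. Positivity of the products makes \<open>nat\<close>
    harmless.\<close>
  have l_le: "real l \<le> n * (\<alpha> / 2)" and l_gt: "n * (\<alpha> / 2) - 1 < real l"
    and u_ge: "n * (1 - \<alpha> / 2) \<le> real u" and u_lt: "real u < n * (1 - \<alpha> / 2) + 1"
    using n \<alpha> mult_pos_pos[of n "\<alpha> / 2"] mult_pos_pos[of n "1 - \<alpha> / 2"] unfolding l_def u_def by linarith+
  have u_card: "u \<le> card ?I"
  proof -
    have "n * (1 - \<alpha> / 2) \<le> n"
      using n \<alpha> by (simp add: mult_le_cancel_left1)
    then have "\<lceil>n * (1 - \<alpha> / 2)\<rceil> \<le> int (card ?I)"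
      using n by (simp add: ceiling_le_iff)
    then show ?thesis
      unfolding u_def by linarith
  qed
  have "n * (1 - \<alpha>) \<le> real (N \<omega>)" if "\<omega> \<in> space M" for \<omega>
  proof -
    have "int u - int l \<le> int (N \<omega>)"
      unfolding N_eq[OF that] using D u_card by (intro card_rank_between_ge) auto
    then have "real u - real l \<le> real (N \<omega>)"
      by linarith
    with l_le u_ge show ?thesis
      by (simp add: algebra_simps)
  qed
  then have "n * (1 - \<alpha>) \<le> n * prob E"
    unfolding prob_eq by (intro integral_ge_const int) auto
  then show "1 - \<alpha> \<le> prob E"
    using n by simp
  assume inj: "AE \<omega> in M. inj_on (\<lambda>t. s t \<omega>) ?I"
  have N_le: "real (N \<omega>) \<le> n * (1 - \<alpha>) + 2" if "\<omega> \<in> space M" "inj_on (\<lambda>t. s t \<omega>) ?I" for \<omega>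
  proof -
    have "N \<omega> \<le> u - l"
      unfolding N_eq[OF that(1)] using D that(2) by (intro card_rank_between_le) auto
    \<comment> \<open>Covers the truncated case \<open>u < l\<close>, where the count is
      zero.\<close>
    moreover have "0 \<le> n * (1 - \<alpha>)"
      using n \<alpha> by simp
    ultimately show ?thesis
      using l_gt u_lt by (cases "l \<le> u") (simp_all add: algebra_simps of_nat_diff)
  qed
  have "n * prob E \<le> n * (1 - \<alpha>) + 2"
    unfolding prob_eq
  proof (intro integral_le_const int)
    show "AE \<omega> in M. real (N \<omega>) \<le> n * (1 - \<alpha>) + 2"
      using inj AE_space by eventually_elim (rule N_le)
  qed
  then have "prob E \<le> 1 - \<alpha> + 2 / n"
    using n by (simp add: field_simps)
  then show "prob E \<le> 1 - \<alpha> + 2 / (real (card D) + 1)"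
    by (simp add: n_def add.commute)
qed

section \<open>The hierarchical conformal procedure\<close>

text \<open>All residuals share the random regressor, so even for i.i.d. data they are in general
  independent only conditionally on the training data; the estimation data are conditioned on as
  well because they determine \<open>P\<close>. Distinctness is imposed in each coordinate, since
  distinct vectors may still tie in one of them.\<close>

theorem theorem2:
  fixes M :: "'w measure"
    and T :: nat and \<alpha> :: real
    and Hsub :: "real^('n::finite)^('k::finite)"
    and x :: "nat \<Rightarrow> 'w \<Rightarrow> real^('d::finite)"
    and y :: "nat \<Rightarrow> 'w \<Rightarrow> real^('n + 'k)"
    and Dtrain Destim Dcalib :: "nat set"
    and \<A> :: "(nat \<Rightarrow> (real^'d) \<times> (real^('n + 'k))) \<Rightarrow> (real^'d \<Rightarrow> real^('n + 'k))"
    and Pmat :: "(real^'d \<Rightarrow> real^('n + 'k)) \<Rightarrow> (nat \<Rightarrow> (real^'d) \<times> (real^('n + 'k)))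
                 \<Rightarrow> real^('n + 'k)^('n + 'k)"
    and \<mu>hat \<mu>tilde :: "'w \<Rightarrow> real^'d \<Rightarrow> real^('n + 'k)"
    and shat stilde :: "nat \<Rightarrow> 'w \<Rightarrow> real^('n + 'k)"
    and Ctilde :: "'w \<Rightarrow> 'n + 'k \<Rightarrow> real^'d \<Rightarrow> real set"
  assumes "prob_space M"
    and alpha: "0 < \<alpha>" "\<alpha> < 1"
    and dim: "2 \<le> CARD('n)"
    and x_meas: "\<And>t. t \<in> {1..T + 1} \<Longrightarrow> x t \<in> borel_measurable M"
    and y_meas: "\<And>t. t \<in> {1..T + 1} \<Longrightarrow> y t \<in> borel_measurable M"
    and coherent: "\<And>t \<omega>. t \<in> {1..T + 1} \<Longrightarrow> \<omega> \<in> space M \<Longrightarrow>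
                      y t \<omega> = hier_matrix Hsub *v (\<chi> j. y t \<omega> $ Inl j)"
    and partition: "Dtrain \<union> Destim \<union> Dcalib = {1..T}"
      "Dtrain \<inter> Destim = {}" "Dtrain \<inter> Dcalib = {}" "Destim \<inter> Dcalib = {}"
    and A_meas: "(\<lambda>(u, \<xi>). \<A> u \<xi>) \<in> borel_measurable (Pi\<^sub>M Dtrain (\<lambda>_. borel) \<Otimes>\<^sub>M borel)"
    and P_meas: "(\<lambda>(u, v). Pmat (\<A> u) v)
                   \<in> borel_measurable (Pi\<^sub>M Dtrain (\<lambda>_. borel) \<Otimes>\<^sub>M Pi\<^sub>M Destim (\<lambda>_. borel))"
    and P_proj: "\<And>\<mu> v. Pmat \<mu> v ** hier_matrix Hsub = hier_matrix Hsub"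
    and muhat: "\<And>\<omega>. \<mu>hat \<omega> = \<A> (sample x y Dtrain \<omega>)"
    and mutilde: "\<And>\<omega> \<xi>. \<mu>tilde \<omega> \<xi> = Pmat (\<mu>hat \<omega>) (sample x y Destim \<omega>) *v \<mu>hat \<omega> \<xi>"
    and shat: "\<And>t \<omega>. shat t \<omega> = y t \<omega> - \<mu>hat \<omega> (x t \<omega>)"
    and stilde: "\<And>t \<omega>. stilde t \<omega> = y t \<omega> - \<mu>tilde \<omega> (x t \<omega>)"
    and Ctilde: "\<And>\<omega> i \<xi>. Ctilde \<omega> i \<xi> =
                   conformal_interval \<alpha> Dcalib (\<lambda>t. stilde t \<omega> $ i) (\<mu>tilde \<omega> \<xi> $ i)"
  shows "(iid_vars M borel (\<lambda>t \<omega>. (x t \<omega>, y t \<omega>)) {1..T + 1} \<longrightarrow>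
           cond_iid_vars M (sample_algebra M x y (Dtrain \<union> Destim)) borel shat (Dcalib \<union> {T + 1})) \<and>
         (cond_iid_vars M (sample_algebra M x y (Dtrain \<union> Destim)) borel shat (Dcalib \<union> {T + 1}) \<longrightarrow>
           (\<forall>i. measure M {\<omega> \<in> space M. y (T + 1) \<omega> $ i \<in> Ctilde \<omega> i (x (T + 1) \<omega>)} \<ge> 1 - \<alpha>) \<and>
           ((AE \<omega> in M. \<forall>i. inj_on (\<lambda>t. stilde t \<omega> $ i) (Dcalib \<union> {T + 1})) \<longrightarrow>
            (\<forall>i. measure M {\<omega> \<in> space M. y (T + 1) \<omega> $ i \<in> Ctilde \<omega> i (x (T + 1) \<omega>)}
                   \<le> 1 - \<alpha> + 2 / (real (card Dcalib) + 1))))"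
proof -
  interpret prob_space M
    by fact
  let ?D = "Dtrain \<union> Destim" and ?I = "Dcalib \<union> {T + 1}"
  let ?N = "Pi\<^sub>M ?D (\<lambda>_. borel :: ((real^'d) \<times> (real^('n + 'k))) measure)"
  define V where "V = sample x y ?D"
  \<comment> \<open>Both \<open>g\<close> and \<open>p\<close> read the joint training and
    estimation sample \<open>v\<close> and recover each part by restriction, so that one
    conditioning variable \<open>V\<close> serves for both.\<close>
  define g where "g = (\<lambda>(v, z). snd z - \<A> (restrict v Dtrain) (fst z))"
  define p where "p v = Pmat (\<A> (restrict v Dtrain)) (restrict v Destim)" for v
  have F: "sample_algebra M x y ?D = vimage_algebra (space M) V ?N"
    by (simp add: sample_algebra_def V_def)
  have I_eq: "?I = insert (T + 1) Dcalib"
    by auto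
  have D_T: "?D \<subseteq> {1..T}" and calib_T: "Dcalib \<subseteq> {1..T}"
    using partition(1) by blast+
  have calib: "finite Dcalib" "T + 1 \<notin> Dcalib"
    using calib_T finite_subset by auto
  have D_sub: "?D \<subseteq> {1..T + 1}" and I_sub: "?I \<subseteq> {1..T + 1}" and disj: "?D \<inter> ?I = {}"
    using D_T calib_T partition(3,4) by fastforce+
  have xy: "(\<lambda>\<omega>. (x t \<omega>, y t \<omega>)) \<in> borel_measurable M" if "t \<in> {1..T + 1}" for t
    using x_meas[OF that] y_meas[OF that] by (rule borel_measurable_Pair)
  have V[measurable]: "V \<in> measurable M ?N"
    unfolding V_def sample_def using D_sub by (intro measurable_restrict xy) auto
  have restrict_V: "restrict (V \<omega>) Dtrain = sample x y Dtrain \<omega>" "restrict (V \<omega>) Destim = sample x y Destim \<omega>" for \<omega>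
    by (auto simp: V_def sample_def fun_eq_iff)
  have rtrain: "(\<lambda>v. restrict v Dtrain) \<in> measurable ?N (Pi\<^sub>M Dtrain (\<lambda>_. borel))"
    and restim: "(\<lambda>v. restrict v Destim) \<in> measurable ?N (Pi\<^sub>M Destim (\<lambda>_. borel))"
    by (intro measurable_restrict_subset; simp)+
  have shat_g: "shat = (\<lambda>t \<omega>. g (V \<omega>, (x t \<omega>, y t \<omega>)))"
    by (simp add: fun_eq_iff g_def restrict_V shat muhat)
  have iid: "cond_iid_vars M (sample_algebra M x y ?D) borel shat ?I"
    if iid: "iid_vars M borel (\<lambda>t \<omega>. (x t \<omega>, y t \<omega>)) {1..T + 1}"
    unfolding F shat_g
  proof (rule cond_iid_vars_of_indep)
    have indep: "indep_vars (\<lambda>_. borel) (\<lambda>t \<omega>. (x t \<omega>, y t \<omega>)) {1..T + 1}"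
      using iid by (simp add: iid_vars_def)
    show "iid_vars M borel (\<lambda>t \<omega>. (x t \<omega>, y t \<omega>)) ?I"
      using iid I_sub indep_vars_subset[OF indep I_sub] unfolding iid_vars_def by blast
    \<comment> \<open>Two disjoint blocks of an independent family are independent.\<close>
    show "indep_var ?N V (Pi\<^sub>M ?I (\<lambda>_. borel)) (\<lambda>\<omega>. \<lambda>t\<in>?I. (x t \<omega>, y t \<omega>))"
      using indep_var_restrict[OF indep disj D_sub I_sub] by (simp only: V_def sample_def[abs_def])
    have fst_m: "(fst :: (real^'d) \<times> (real^('n + 'k)) \<Rightarrow> _) \<in> borel_measurable borel"
      and snd_m: "(snd :: (real^'d) \<times> (real^('n + 'k)) \<Rightarrow> _) \<in> borel_measurable borel"
      by (intro borel_measurable_continuous_onI continuous_intros)+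
    let ?Z = "borel :: ((real^'d) \<times> (real^('n + 'k))) measure"
    have "(\<lambda>q. (restrict (fst q) Dtrain, fst (snd q))) \<in> measurable (?N \<Otimes>\<^sub>M ?Z) (Pi\<^sub>M Dtrain (\<lambda>_. borel) \<Otimes>\<^sub>M borel)"
      by (intro measurable_Pair measurable_compose[OF measurable_fst rtrain] measurable_compose[OF measurable_snd fst_m])
    from measurable_compose[OF this A_meas]
    have "(\<lambda>q. snd (snd q) - \<A> (restrict (fst q) Dtrain) (fst (snd q))) \<in> borel_measurable (?N \<Otimes>\<^sub>M ?Z)"
      by (intro borel_measurable_diff measurable_compose[OF measurable_snd snd_m]) simp
    then show "g \<in> borel_measurable (?N \<Otimes>\<^sub>M borel)"
      by (simp add: g_def case_prod_beta')
  qed (use calib in auto)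
  have stilde_p: "stilde t \<omega> = p (V \<omega>) *v shat t \<omega>" if "t \<in> {1..T + 1}" "\<omega> \<in> space M" for t \<omega>
  proof -
    \<comment> \<open>Coherence writes \<open>y t \<omega>\<close> as \<open>H\<close> applied to a
      vector, and \<open>P H = H\<close> makes \<open>P\<close> fix it. Hence projecting the
      forecast projects the residual.\<close>
    have "p (V \<omega>) *v y t \<omega> = y t \<omega>"
      by (subst (1 2) coherent[OF that]) (simp add: p_def matrix_vector_mul_assoc P_proj)
    then show ?thesis
      by (simp add: stilde mutilde shat matrix_vector_mult_diff_distrib p_def restrict_V muhat)
  qed
  have cover: "1 - \<alpha> \<le> prob {\<omega> \<in> space M. y (T + 1) \<omega> $ i \<in> Ctilde \<omega> i (x (T + 1) \<omega>)}"
    and cover_distinct: "(AE \<omega> in M. \<forall>i. inj_on (\<lambda>t. stilde t \<omega> $ i) ?I) \<Longrightarrow>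
      prob {\<omega> \<in> space M. y (T + 1) \<omega> $ i \<in> Ctilde \<omega> i (x (T + 1) \<omega>)} \<le> 1 - \<alpha> + 2 / (real (card Dcalib) + 1)"
    if cond: "cond_iid_vars M (sample_algebra M x y ?D) borel shat ?I" for i
  proof -
    \<comment> \<open>One coordinate of the projected residual, as a function of the conditioning
      data and a single residual.\<close>
    define h where "h q = (p (fst q) *v snd q) $ i" for q
    let ?s = "\<lambda>t \<omega>. h (V \<omega>, shat t \<omega>)" and ?c = "\<lambda>\<omega>. \<mu>tilde \<omega> (x (T + 1) \<omega>) $ i"
    have entry: "(\<lambda>A. A $ i $ j) \<in> borel_measurable (borel :: (real^('n + 'k)^('n + 'k)) measure)"
      and coord: "(\<lambda>w. w $ j) \<in> borel_measurable (borel :: (real^('n + 'k)) measure)" for j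
      by (intro borel_measurable_continuous_onI continuous_intros)+
    have p_m: "p \<in> borel_measurable ?N"
      using measurable_compose[OF measurable_Pair[OF rtrain restim] P_meas] by (simp add: p_def[abs_def])
    have "h \<in> borel_measurable (?N \<Otimes>\<^sub>M borel)"
      unfolding h_def matrix_vector_mult_def vec_lambda_beta
      by (intro borel_measurable_sum borel_measurable_times measurable_compose[OF measurable_snd coord]
          measurable_compose[OF measurable_compose[OF measurable_fst p_m] entry])
    then have ex: "exchangeable M borel ?s (insert (T + 1) Dcalib)"
      using cond calib V unfolding F I_eq by (intro exchangeable_of_cond_iid) auto
    have s_eq: "?s t \<omega> = stilde t \<omega> $ i" if "t \<in> ?I" "\<omega> \<in> space M" for t \<omega>
      using stilde_p[OF subsetD[OF I_sub that(1)] that(2)] by (simp add: h_def)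
    have E: "{\<omega> \<in> space M. y (T + 1) \<omega> $ i \<in> Ctilde \<omega> i (x (T + 1) \<omega>)}
        = {\<omega> \<in> space M. ?c \<omega> + ?s (T + 1) \<omega> \<in> conformal_interval \<alpha> Dcalib (\<lambda>t. ?s t \<omega>) (?c \<omega>)}"
    proof (intro Collect_cong conj_cong refl)
      fix \<omega> assume \<omega>: "\<omega> \<in> space M"
      \<comment> \<open>The two score families are known to agree only on \<open>?I\<close>, and
        order statistics read only the values on \<open>Dcalib\<close>.\<close>
      have "map (\<lambda>t. ?s t \<omega>) (sorted_list_of_set Dcalib) = map (\<lambda>t. stilde t \<omega> $ i) (sorted_list_of_set Dcalib)"
        using calib \<omega> by (intro map_cong s_eq) auto
      then have "order_stat Dcalib (\<lambda>t. ?s t \<omega>) k = order_stat Dcalib (\<lambda>t. stilde t \<omega> $ i) k" for k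
        by (simp only: order_stat_def)
      then show "y (T + 1) \<omega> $ i \<in> Ctilde \<omega> i (x (T + 1) \<omega>) \<longleftrightarrow>
          ?c \<omega> + ?s (T + 1) \<omega> \<in> conformal_interval \<alpha> Dcalib (\<lambda>t. ?s t \<omega>) (?c \<omega>)"
        using \<omega> by (simp add: Ctilde conformal_interval_def s_eq stilde)
    qed
    note cov = exchangeable_conformal_coverage[OF ex calib alpha, of ?c]
    show "1 - \<alpha> \<le> prob {\<omega> \<in> space M. y (T + 1) \<omega> $ i \<in> Ctilde \<omega> i (x (T + 1) \<omega>)}"
      unfolding E by (rule cov(1))
    assume "AE \<omega> in M. \<forall>i. inj_on (\<lambda>t. stilde t \<omega> $ i) ?I"
    then have "AE \<omega> in M. inj_on (\<lambda>t. ?s t \<omega>) (insert (T + 1) Dcalib)"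
    proof (rule AE_mp, intro AE_I2 impI)
      fix \<omega> assume "\<omega> \<in> space M" "\<forall>i. inj_on (\<lambda>t. stilde t \<omega> $ i) ?I"
      then show "inj_on (\<lambda>t. ?s t \<omega>) (insert (T + 1) Dcalib)"
        unfolding I_eq[symmetric] using s_eq by (simp add: inj_on_def)
    qed
    then show "prob {\<omega> \<in> space M. y (T + 1) \<omega> $ i \<in> Ctilde \<omega> i (x (T + 1) \<omega>)} \<le> 1 - \<alpha> + 2 / (real (card Dcalib) + 1)"
      unfolding E by (rule cov(2))
  qed
  show ?thesis
    using iid cover cover_distinct by blast
qed

end
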